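(* Let $(F,O)$ be a MaxSAT instance, $\alpha$ a partial assignment, $v^*$ an integer, and $\mathcal{C}$ an $O$-compatible set of weighted local cores of $(F,O)$ relative to $\alpha$; let $|O|$ be the number of objective literals. (1) If $w(\mathcal{C})\ge v^*$, then there is a cutting planes derivation that derives the clause $C_{\mathcal{C}}$ from the constraint $O\le v^*-1$ and the clauses $C_q$ for every $q\in\mathcal{C}$, using at most $3|O|+2|\mathcal{C}|+1$ steps. (2) If for some objective literal $\ell$ unassigned by $\alpha$ we have $r(\ell,\mathcal{C})+w(\mathcal{C})\ge v^*$, then there is a cutting planes derivation that derives the clause $C_{\mathcal{C}}\vee\bar\ell$ from the constraint $O\le v^*-1$ and the clauses $C_q$ for every $q\in\mathcal{C}$, using at most $3|O|+2|\mathcal{C}|-2$ steps.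
   Context: All variables are Boolean; a literal is $x$ or $\bar x=1-x$. A pseudo-Boolean (PB) constraint is $\sum_i w_i\ell_i\ge A$ (or $\le$) with integer $w_i,A$ and literals $\ell_i$; a clause $\ell_1\vee\dots\vee\ell_m$ is the PB constraint $\sum_j \ell_j\ge 1$. A partial assignment is identified with the set of literals it makes true. A MaxSAT instance is $(F,O)$ with $F$ a conjunction of clauses and $O=\sum_i c_ib_i$ to be minimized, $c_i$ positive integers, $b_i$ distinct literals (objective literals); $c(\ell)=c_i$ if $\ell=b_i$ and $0$ otherwise. A weighted local core relative to $\alpha$ is a triple $q=\langle w,R,K\rangle$ with $w$ a positive integer, $R\subseteq\alpha$, $K$ a set of negations of objective literals, and $F\wedge R\wedge K\models\bot$. For such $q$, $C_q:=\bigvee_{\ell\in R\cup K}\bar\ell$. A set $\mathcal{C}$ of such cores is $O$-compatible if $\sum_{\langle w,R,K\rangle\in\mathcal{C},\,\bar\ell\in K}w\le c(\ell)$ for every objective literal $\ell$; $r(\ell,\mathcal{C})=c(\ell)-\sum_{\langle w,R,K\rangle\in\mathcal{C},\,\bar\ell\in K}w$; $w(\mathcal{C})=\sum_{\langle w,R,K\rangle\in\mathcal{C}}w$; and $C_{\mathcal{C}}:=\bigvee_{\langle w,R,K\rangle\in\mathcal{C},\ \ell\in R}\bar\ell$. A cutting planes derivation is a sequence of steps, each one of: a literal axiom (add $\ell\ge 0$ for a literal $\ell$); multiplication of a derived constraint by a positive integer; addition of two derived constraints; division (from a normalized constraint $\sum_i w_i\ell_i\ge A$ with nonnegative $w_i,A$,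 and positive integer $c$, derive $\sum_i\lceil w_i/c\rceil\ell_i\ge\lceil A/c\rceil$); saturation (from normalized $\sum_i a_i\ell_i\ge A$ derive $\sum_i\min(a_i,A)\ell_i\ge A$). Constraints are identified up to normalization using $\bar x=1-x$ and merging of terms. *)

theory Defs
  imports Complex_Main "HOL-Library.Poly_Mapping"
begin

datatype 'v literal = Pos (var: 'v) | Neg (var: 'v)

fun neg :: "'v literal \<Rightarrow> 'v literal" where
  "neg (Pos x) = Neg x"
| "neg (Neg x) = Pos x"

fun lit_val :: "('v \<Rightarrow> bool) \<Rightarrow> 'v literal \<Rightarrow> int" where
  "lit_val \<tau> (Pos x) = of_bool (\<tau> x)"
| "lit_val \<tau> (Neg x) = 1 - of_bool (\<tau> x)"


subsection \<open>Pseudo-Boolean constraints\<close>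

text \<open>
  \<open>PB_ge w A\<close> is the constraint \<open>\<Sum>\<^sub>l w l * l \<ge> A\<close>, where \<open>w\<close> is a finitely supported
  family of integer coefficients indexed by literals.  Coefficients may be negative, and
  \<open>x\<close> and its negation may both occur.
\<close>

datatype 'v pbc = PB_ge (coeffs: "'v literal \<Rightarrow>\<^sub>0 int") (degree: int)

definition PB_le :: "('v literal \<Rightarrow>\<^sub>0 int) \<Rightarrow> int \<Rightarrow> 'v pbc" where
  "PB_le w A = PB_ge (- w) (- A)"

definition sat_pbc :: "('v \<Rightarrow> bool) \<Rightarrow> 'v pbc \<Rightarrow> bool" where
  "sat_pbc \<tau> C \<longleftrightarrow>
     (\<Sum>l\<in>Poly_Mapping.keys (coeffs C). Poly_Mapping.lookup (coeffs C) l * lit_val \<tau> l) \<ge> degree C"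

definition clause_pbc :: "'v literal set \<Rightarrow> 'v pbc" where
  "clause_pbc C = PB_ge (\<Sum>l\<in>C. Poly_Mapping.single l 1) 1"

text \<open>
  Normalization subtracts \<open>m * (x + neg x) = m\<close> for every variable \<open>x\<close>, where \<open>m\<close> is the
  smaller of the two coefficients.  This leaves nonnegative coefficients with at most one
  literal per variable, also when some of the original coefficients are negative.
\<close>

definition min_coeff :: "('v literal \<Rightarrow>\<^sub>0 int) \<Rightarrow> 'v \<Rightarrow> int" where
  "min_coeff w x = min (Poly_Mapping.lookup w (Pos x)) (Poly_Mapping.lookup w (Neg x))"

definition normalize_pbc :: "'v pbc \<Rightarrow> 'v pbc" where
  "normalize_pbc C =
     (let w = coeffs C; V = var ` Poly_Mapping.keys w in
      PB_ge
        (w - (\<Sum>x\<in>V. Poly_Mapping.single (Pos x) (min_coeff w x)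
                     + Poly_Mapping.single (Neg x) (min_coeff w x)))
        (degree C - (\<Sum>x\<in>V. min_coeff w x)))"

definition pbc_equiv :: "'v pbc \<Rightarrow> 'v pbc \<Rightarrow> bool" where
  "pbc_equiv C D \<longleftrightarrow> normalize_pbc C = normalize_pbc D"

text \<open>
  The degree is required to be nonnegative as well: with a negative degree, saturation
  would be unsound.
\<close>

definition normalized :: "'v pbc \<Rightarrow> bool" where
  "normalized C \<longleftrightarrow>
     (\<forall>l. Poly_Mapping.lookup (coeffs C) l \<ge> 0) \<and> degree C \<ge> 0 \<and>
     (\<forall>l\<in>Poly_Mapping.keys (coeffs C). neg l \<notin> Poly_Mapping.keys (coeffs C))"


subsection \<open>Cutting planes\<close>

inductive cp_step :: "'v pbc set \<Rightarrow> 'v pbc \<Rightarrow> bool" for S where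
  literal_axiom: "cp_step S (PB_ge (Poly_Mapping.single l 1) 0)"
| multiplication:
    "PB_ge w A \<in> S \<Longrightarrow> k > 0 \<Longrightarrow>
     cp_step S (PB_ge (Poly_Mapping.map (\<lambda>a. k * a) w) (k * A))"
| addition:
    "PB_ge w A \<in> S \<Longrightarrow> PB_ge w' A' \<in> S \<Longrightarrow> cp_step S (PB_ge (w + w') (A + A'))"
| division:
    "PB_ge w A \<in> S \<Longrightarrow> normalized (PB_ge w A) \<Longrightarrow> k > 0 \<Longrightarrow>
     cp_step S (PB_ge (Poly_Mapping.map (\<lambda>a. \<lceil>real_of_int a / real_of_int k\<rceil>) w)
                      \<lceil>real_of_int A / real_of_int k\<rceil>)"
| saturation:
    "PB_ge w A \<in> S \<Longrightarrow> normalized (PB_ge w A) \<Longrightarrow>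
     cp_step S (PB_ge (Poly_Mapping.map (\<lambda>a. min a A) w) A)"

text \<open>
  The list \<open>D\<close> contains one constraint per step; the premises \<open>P\<close> are not steps.  Constraints
  are identified up to normalization, so a rule may be applied to any representative of an
  available constraint, and only the class of its result matters.
\<close>

definition cp_derivation :: "'v pbc set \<Rightarrow> 'v pbc list \<Rightarrow> 'v pbc \<Rightarrow> bool" where
  "cp_derivation P D C \<longleftrightarrow>
     (\<forall>i<length D. \<exists>E. cp_step {B. \<exists>B'\<in>P \<union> set (take i D). pbc_equiv B B'} E \<and> pbc_equiv (D ! i) E) \<and>
     (\<exists>B\<in>P \<union> set D. pbc_equiv B C)"


subsection \<open>MaxSAT instances and weighted local cores\<close>

text \<open>
  An objective maps each objective literal \<open>b\<^sub>i\<close> to its cost \<open>c\<^sub>i\<close> and all other literals to 0,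
  so that \<open>lookup Obj\<close> is the cost function and \<open>keys Obj\<close> is the set of objective literals.
\<close>

definition maxsat_instance :: "'v literal set set \<Rightarrow> ('v literal \<Rightarrow>\<^sub>0 int) \<Rightarrow> bool" where
  "maxsat_instance F Obj \<longleftrightarrow>
     finite F \<and> (\<forall>C\<in>F. finite C) \<and>
     (\<forall>l\<in>Poly_Mapping.keys Obj. Poly_Mapping.lookup Obj l > 0)"

definition partial_assignment :: "'v literal set \<Rightarrow> bool" where
  "partial_assignment \<alpha> \<longleftrightarrow> finite \<alpha> \<and> (\<forall>l\<in>\<alpha>. neg l \<notin> \<alpha>)"

definition unassigned :: "'v literal set \<Rightarrow> 'v literal \<Rightarrow> bool" where
  "unassigned \<alpha> l \<longleftrightarrow> l \<notin> \<alpha> \<and> neg l \<notin> \<alpha>"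

text \<open>A core is a triple \<open>(w, R, K)\<close>.\<close>

type_synonym 'v core = "int \<times> 'v literal set \<times> 'v literal set"

definition weighted_local_core ::
  "'v literal set set \<Rightarrow> ('v literal \<Rightarrow>\<^sub>0 int) \<Rightarrow> 'v literal set \<Rightarrow> 'v core \<Rightarrow> bool" where
  "weighted_local_core F Obj \<alpha> q \<longleftrightarrow>
     (case q of (w, R, K) \<Rightarrow>
        w > 0 \<and> R \<subseteq> \<alpha> \<and> K \<subseteq> neg ` Poly_Mapping.keys Obj \<and>
        \<not> (\<exists>\<tau>. (\<forall>C\<in>F. sat_pbc \<tau> (clause_pbc C)) \<and> (\<forall>l\<in>R \<union> K. lit_val \<tau> l = 1)))"

definition core_clause :: "'v core \<Rightarrow> 'v literal set" where
  "core_clause q = (case q of (w, R, K) \<Rightarrow> neg ` (R \<union> K))"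

definition cores_clause :: "'v core set \<Rightarrow> 'v literal set" where
  "cores_clause \<C> = {neg l | l w R K. (w, R, K) \<in> \<C> \<and> l \<in> R}"

definition cores_weight :: "'v core set \<Rightarrow> int" where
  "cores_weight \<C> = (\<Sum>(w, R, K)\<in>\<C>. w)"

definition used_cost :: "'v core set \<Rightarrow> 'v literal \<Rightarrow> int" where
  "used_cost \<C> l = (\<Sum>(w, R, K)\<in>{(w, R, K). (w, R, K) \<in> \<C> \<and> neg l \<in> K}. w)"

definition compatible :: "('v literal \<Rightarrow>\<^sub>0 int) \<Rightarrow> 'v core set \<Rightarrow> bool" where
  "compatible Obj \<C> \<longleftrightarrow>
     (\<forall>l\<in>Poly_Mapping.keys Obj. used_cost \<C> l \<le> Poly_Mapping.lookup Obj l)"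

definition residual :: "('v literal \<Rightarrow>\<^sub>0 int) \<Rightarrow> 'v literal \<Rightarrow> 'v core set \<Rightarrow> int" where
  "residual Obj l \<C> = Poly_Mapping.lookup Obj l - used_cost \<C> l"

end

(*
  Add k times O <= v - 1 to a sum of positive multiples u_q of the clauses C_q.  Compatibility
  makes the coefficient of every objective literal outside C_C nonpositive, so a multiple of a
  literal axiom (three steps per objective literal) repairs it; an objective literal that
  also lies in C_C gets enough to leave it a positive coefficient.  What remains has a positive
  degree and is supported exactly on C_C, and dividing by a number at least as large as all
  coefficients and the degree turns it into the clause.  For (1), k = 1 and u_q = w_q.

  For (2) the literal l is not repaired.  Its coefficient -d with d > 0 is d * neg l - d
  after normalization, so neg l joins the clause.  With k = 1 and u_q = w_q we have d = r(l).
  If r(l) = 0, some core q has neg l in K, and lowering its multiplier makes d = 1: if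
  w_q > 1 use w_q - 1; if w_q = 1, double everything except C_q, which needs no
  multiplication step any more and so pays for the doubling of O <= v - 1.
*)

theory Submission
  imports Defs
begin

section \<open>Derivations with a bound on their length\<close>

text \<open>An upper bound, not an exact length, lets step counts be added and then weakened by
  plain arithmetic.\<close>

definition cp_within :: "'v pbc set \<Rightarrow> nat \<Rightarrow> 'v pbc \<Rightarrow> bool" where
  "cp_within P n C \<longleftrightarrow> (\<exists>D. cp_derivation P D C \<and> length D \<le> n)"

lemma cp_step_mono:
  assumes "cp_step S E" "S \<subseteq> S'"
  shows "cp_step S' E"
  using assms(1) by cases (use assms(2) in \<open>auto intro: cp_step.intros\<close>)

lemma pbc_equiv_refl [simp]: "pbc_equiv C C"
  by (simp add: pbc_equiv_def)

lemma cp_derivation_snoc: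
  assumes "cp_derivation P D C"
    and "cp_step {B. \<exists>B'\<in>P \<union> set D. pbc_equiv B B'} E"
  shows "cp_derivation P (D @ [E]) E"
  unfolding cp_derivation_def
proof (intro conjI allI impI)
  fix i assume "i < length (D @ [E])"
  then consider "i < length D" | "i = length D"
    by fastforce
  then show "\<exists>E'. cp_step {B. \<exists>B'\<in>P \<union> set (take i (D @ [E])). pbc_equiv B B'} E' \<and>
      pbc_equiv ((D @ [E]) ! i) E'"
  proof cases
    case 1
    then show ?thesis
      using assms(1) by (simp add: cp_derivation_def nth_append)
  next
    case 2
    then show ?thesis
      using assms(2) pbc_equiv_refl by (auto simp: nth_append)
  qed
qed (auto intro: bexI[of _ E])

text \<open>The steps of \<open>D'\<close> survive behind \<open>D\<close> because a larger set of
  available constraints invalidates no step. Both conclusions are kept, since an addition needs its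
  two summands at once.\<close>

lemma cp_derivation_append:
  assumes "cp_derivation P D C" "cp_derivation P D' C'"
  shows "cp_derivation P (D @ D') C" "cp_derivation P (D @ D') C'"
proof -
  have "\<exists>E. cp_step {B. \<exists>B'\<in>P \<union> set (take i (D @ D')). pbc_equiv B B'} E \<and>
      pbc_equiv ((D @ D') ! i) E" if "i < length (D @ D')" for i
  proof (cases "i < length D")
    case True
    then show ?thesis
      using assms(1) by (simp add: cp_derivation_def nth_append)
  next
    case False
    then have "i - length D < length D'"
      using that by simp
    then obtain E where
      E: "cp_step {B. \<exists>B'\<in>P \<union> set (take (i - length D) D'). pbc_equiv B B'} E"
         "pbc_equiv (D' ! (i - length D)) E"
      using assms(2) by (auto simp: cp_derivation_def)
    then show ?thesis
      using False by (auto simp: nth_append intro!: exI[of _ E] elim!: cp_step_mono)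
  qed
  then show "cp_derivation P (D @ D') C" "cp_derivation P (D @ D') C'"
    using assms unfolding cp_derivation_def by (auto 0 4)
qed

lemma cp_within_mono: "cp_within P m C \<Longrightarrow> m \<le> n \<Longrightarrow> cp_within P n C"
  unfolding cp_within_def using order_trans by blast

lemma cp_within_premise: "C \<in> P \<Longrightarrow> cp_within P 0 C"
  unfolding cp_within_def cp_derivation_def by (auto intro!: bexI[of _ C])

text \<open>Passing to another representative of the same normalization class costs no step. This is
  what makes the rewriting of a negative coefficient free.\<close>

lemma cp_derivation_equiv:
  assumes "cp_derivation P D C" "pbc_equiv C C'"
  shows "cp_derivation P D C'"
proof -
  obtain B where "B \<in> P \<union> set D" "pbc_equiv B C"
    using assms(1) unfolding cp_derivation_def by blast
  moreover from this assms(2) have "pbc_equiv B C'"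
    by (simp add: pbc_equiv_def)
  ultimately show ?thesis
    using assms(1) unfolding cp_derivation_def by blast
qed

lemma cp_derivation_available:
  assumes "cp_derivation P D C"
  shows "C \<in> {B. \<exists>B'\<in>P \<union> set D. pbc_equiv B B'}"
proof -
  obtain B where "B \<in> P \<union> set D" "pbc_equiv B C"
    using assms unfolding cp_derivation_def by blast
  moreover from this have "pbc_equiv C B"
    by (simp add: pbc_equiv_def)
  ultimately show ?thesis
    by blast
qed

lemma cp_within_equiv: "cp_within P n C \<Longrightarrow> pbc_equiv C C' \<Longrightarrow> cp_within P n C'"
  unfolding cp_within_def using cp_derivation_equiv by blast

lemma cp_within_step:
  assumes "cp_within P n C" "cp_step {C} E"
  shows "cp_within P (Suc n) E"
proof -
  obtain D where D: "cp_derivation P D C" "length D \<le> n"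
    using assms(1) by (auto simp: cp_within_def)
  have "{C} \<subseteq> {B. \<exists>B'\<in>P \<union> set D. pbc_equiv B B'}"
    using cp_derivation_available[OF D(1)] by blast
  then have "cp_derivation P (D @ [E]) E"
    using cp_derivation_snoc[OF D(1)] cp_step_mono[OF assms(2)] by blast
  then show ?thesis
    using D(2) unfolding cp_within_def by (intro exI[of _ "D @ [E]"]) simp
qed

lemma cp_within_literal: "cp_within P 1 (PB_ge (Poly_Mapping.single l 1) 0)"
  unfolding cp_within_def cp_derivation_def
  by (intro exI[of _ "[PB_ge (Poly_Mapping.single l 1) 0]"])
     (auto intro!: exI[of _ "PB_ge (Poly_Mapping.single l 1) 0"] cp_step.literal_axiom)

lemma cp_within_add:
  assumes "cp_within P m (PB_ge w A)" "cp_within P n (PB_ge w' A')"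
  shows "cp_within P (Suc (m + n)) (PB_ge (w + w') (A + A'))"
proof -
  obtain D where D: "cp_derivation P D (PB_ge w A)" "length D \<le> m"
    using assms(1) by (auto simp: cp_within_def)
  obtain D' where D': "cp_derivation P D' (PB_ge w' A')" "length D' \<le> n"
    using assms(2) by (auto simp: cp_within_def)
  let ?S = "{B. \<exists>B'\<in>P \<union> set (D @ D'). pbc_equiv B B'}"
  note DD' = cp_derivation_append[OF D(1) D'(1)]
  have "PB_ge w A \<in> ?S" "PB_ge w' A' \<in> ?S"
    by (rule cp_derivation_available[OF DD'(1)], rule cp_derivation_available[OF DD'(2)])
  then have "cp_step ?S (PB_ge (w + w') (A + A'))"
    by (rule cp_step.addition)
  from cp_derivation_snoc[OF DD'(1) this] show ?thesis
    using D(2) D'(2) unfolding cp_within_def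
    by (intro exI[of _ "(D @ D') @ [PB_ge (w + w') (A + A')]"]) simp
qed

text \<open>Multiplication by 1 is charged nothing; the second claim meets its bound only by
  exploiting this saving.\<close>

lemma cp_within_scale:
  assumes "cp_within P n (PB_ge w A)" "k > 0"
  shows "cp_within P (n + of_bool (k \<noteq> 1)) (PB_ge (Poly_Mapping.map ((*) k) w) (k * A))"
proof (cases "k = 1")
  case True
  have "Poly_Mapping.map ((*) 1) w = w"
    by (rule poly_mapping_eqI) (simp add: Poly_Mapping.map.rep_eq when_def)
  then show ?thesis
    using assms True by simp
next
  case False
  show ?thesis
    using cp_within_step[OF assms(1) cp_step.multiplication[OF _ assms(2)]] False by simp
qed

text \<open>Dividing by a large enough number rounds the degree and every coefficient in (0,
  \<open>k\<close>] up to 1. The absence of opposite literals in \<open>T\<close> makes the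
  constraint normalized, as division demands.\<close>

lemma cp_within_clause:
  assumes "cp_within P n (PB_ge g A)" "A \<ge> 1" "\<And>l. l \<in> T \<Longrightarrow> neg l \<notin> T"
    and pos: "\<And>l. l \<in> T \<Longrightarrow> Poly_Mapping.lookup g l > 0"
    and zero: "\<And>l. l \<notin> T \<Longrightarrow> Poly_Mapping.lookup g l = 0"
  shows "cp_within P (Suc n) (clause_pbc T)"
proof -
  let ?g = "Poly_Mapping.lookup g"
  have iff: "?g l \<noteq> 0 \<longleftrightarrow> l \<in> T" for l
    using pos[of l] zero[of l] by (cases "l \<in> T") auto
  have T: "Poly_Mapping.keys g = T"
    by (simp add: set_eq_iff in_keys_iff iff)
  have fin: "finite T"
    using finite_keys[of g] T by simp
  have nonneg: "?g l \<ge> 0" for l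
    using pos[of l] zero[of l] by (cases "l \<in> T") auto
  \<comment> \<open>All summands are nonnegative, so this one number dominates the degree and each
    coefficient.\<close>
  define k where "k = A + sum ?g T"
  have k: "k > 0" "A \<le> k"
    using assms(2) sum_nonneg[of T ?g] nonneg by (auto simp: k_def)
  have ceil: "\<lceil>real_of_int a / real_of_int k\<rceil> = 1" if "0 < a" "a \<le> k" for a
    using that by (simp add: ceiling_eq_iff)
  have le: "?g l \<le> k" if "l \<in> T" for l
    using member_le_sum[of l T ?g] that fin nonneg assms(2) by (simp add: k_def)
  have "normalized (PB_ge g A)"
    unfolding normalized_def pbc.sel T using assms(2,3) nonneg by simp
  then have "cp_step {PB_ge g A} (PB_ge (Poly_Mapping.map (\<lambda>a. \<lceil>real_of_int a / real_of_int k\<rceil>) g)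
      \<lceil>real_of_int A / real_of_int k\<rceil>)"
    by (intro cp_step.division) (use k in auto)
  moreover have "Poly_Mapping.map (\<lambda>a. \<lceil>real_of_int a / real_of_int k\<rceil>) g =
      (\<Sum>l\<in>T. Poly_Mapping.single l 1)"
  proof (rule poly_mapping_eqI)
    fix l
    show "Poly_Mapping.lookup (Poly_Mapping.map (\<lambda>a. \<lceil>real_of_int a / real_of_int k\<rceil>) g) l =
      Poly_Mapping.lookup (\<Sum>l\<in>T. Poly_Mapping.single l 1) l"
    proof (cases "l \<in> T")
      case True
      then show ?thesis
        using ceil[OF pos[OF True] le[OF True]] fin
        by (simp add: Poly_Mapping.map.rep_eq lookup_sum lookup_single when_def iff)
    next
      case False
      then show ?thesis
        using fin by (simp add: Poly_Mapping.map.rep_eq lookup_sum lookup_single when_def iff)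
    qed
  qed
  moreover have "\<lceil>real_of_int A / real_of_int k\<rceil> = 1"
    using ceil k assms(2) by simp
  ultimately show ?thesis
    using cp_within_step[OF assms(1)] by (simp add: clause_pbc_def)
qed

section \<open>Negation, finiteness and normalization\<close>

lemma neg_neg [simp]: "neg (neg l) = l"
  by (cases l) auto

lemma neg_eq_iff [simp]: "neg l = neg l' \<longleftrightarrow> l = l'"
  by (metis neg_neg)

lemma neg_neq [simp]: "neg l \<noteq> l" "l \<noteq> neg l"
  by (cases l; simp)+

lemma in_neg_image_iff: "l \<in> neg ` A \<longleftrightarrow> neg l \<in> A"
  by (metis image_iff neg_neg)

text \<open>Finiteness matters because the sum in \<open>clause_pbc\<close> would default to 0 over
  an infinite set.\<close>

lemma finite_core_clause:
  assumes "partial_assignment \<alpha>" "weighted_local_core F Obj \<alpha> q"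
  shows "finite (core_clause q)"
  using assms finite_subset[of _ \<alpha>] finite_subset[of _ "neg ` Poly_Mapping.keys Obj"]
  by (auto simp: partial_assignment_def weighted_local_core_def core_clause_def split: prod.splits)

text \<open>Variables outside the support have \<open>min_coeff\<close> 0 and contribute nothing.
  Constraints with different supports can thus be normalized over one common set of
  variables.\<close>

lemma normalize_pbc_superset:
  assumes "finite V" "var ` Poly_Mapping.keys w \<subseteq> V"
  shows "normalize_pbc (PB_ge w A) = PB_ge
    (w - (\<Sum>x\<in>V. Poly_Mapping.single (Pos x) (min_coeff w x) + Poly_Mapping.single (Neg x) (min_coeff w x)))
    (A - (\<Sum>x\<in>V. min_coeff w x))"
proof -
  have "min_coeff w x = 0" if "x \<notin> var ` Poly_Mapping.keys w" for x
  proof -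
    have "Pos x \<notin> Poly_Mapping.keys w" "Neg x \<notin> Poly_Mapping.keys w"
      using that by force+
    then show ?thesis
      by (simp add: min_coeff_def in_keys_iff)
  qed
  then have "(\<Sum>x\<in>var ` Poly_Mapping.keys w. f x) = sum f V" if "\<And>x. min_coeff w x = 0 \<Longrightarrow> f x = 0"
    for f :: "_ \<Rightarrow> 'b::comm_monoid_add"
    using that assms by (intro sum.mono_neutral_left) auto
  from this[of "min_coeff w"]
    this[of "\<lambda>x. Poly_Mapping.single (Pos x) (min_coeff w x) + Poly_Mapping.single (Neg x) (min_coeff w x)"]
  show ?thesis
    by (simp add: normalize_pbc_def Let_def)
qed

text \<open>A literal and its negation sum to 1. Raising both coefficients by \<open>a\<close>
  shifts their minimum by \<open>a\<close>, and normalization subtracts exactly that again. The sign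
  of \<open>a\<close> is arbitrary.\<close>

lemma pbc_equiv_add_literal_pair:
  "pbc_equiv (PB_ge w A) (PB_ge (w + (Poly_Mapping.single l a + Poly_Mapping.single (neg l) a)) (A + a))"
proof -
  let ?s = "\<lambda>x c. Poly_Mapping.single (Pos x) c + Poly_Mapping.single (Neg x) c"
  let ?y = "var l"
  have pair: "Poly_Mapping.single l a + Poly_Mapping.single (neg l) a = ?s ?y a"
    by (cases l) (auto simp: add.commute)
  define w' where "w' = w + ?s ?y a"
  define V where "V = insert ?y (var ` Poly_Mapping.keys w)"
  have V: "finite V" "?y \<in> V" "var ` Poly_Mapping.keys w \<subseteq> V"
    by (auto simp: V_def)
  \<comment> \<open>Only an inclusion holds, since the added pair may cancel coefficients of
    \<open>w\<close>.\<close>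
  have "Poly_Mapping.keys w' \<subseteq> Poly_Mapping.keys w \<union> {Pos ?y, Neg ?y}"
    unfolding w'_def by (auto simp: in_keys_iff lookup_add lookup_single when_def split: if_splits)
  then have V': "var ` Poly_Mapping.keys w' \<subseteq> V"
    by (auto simp: V_def)
  have min': "min_coeff w' x = min_coeff w x + (if x = ?y then a else 0)" for x
    by (simp add: w'_def min_coeff_def lookup_add lookup_single when_def min_add_distrib_left)
  have "(\<Sum>x\<in>V. ?s x (min_coeff w' x)) =
      (\<Sum>x\<in>V. ?s x (min_coeff w x) + (if x = ?y then ?s ?y a else 0))"
    by (intro sum.cong) (auto simp: min' single_add ac_simps)
  then have 1: "(\<Sum>x\<in>V. ?s x (min_coeff w' x)) = (\<Sum>x\<in>V. ?s x (min_coeff w x)) + ?s ?y a"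
    using V by (simp only: sum.distrib sum.delta') (simp add: sum.delta)
  have 2: "(\<Sum>x\<in>V. min_coeff w' x) = (\<Sum>x\<in>V. min_coeff w x) + a"
    using V by (simp add: min' sum.distrib)
  show ?thesis
    unfolding pbc_equiv_def pair w'_def[symmetric] normalize_pbc_superset[OF V(1) V(3)]
      normalize_pbc_superset[OF V(1) V'] 1 2
    by (simp add: w'_def)
qed

section \<open>Adding multiples of clauses and of literal axioms\<close>

text \<open>Premises are free, so each clause costs one addition, plus one multiplication when its
  multiplier differs from 1.\<close>

lemma cp_within_add_clauses:
  assumes "finite Q" "cp_within P n (PB_ge g A)"
    and "\<And>q. q \<in> Q \<Longrightarrow> clause_pbc (cl q) \<in> P \<and> u q > 0"
  shows "cp_within P (n + (\<Sum>q\<in>Q. Suc (of_bool (u q \<noteq> 1))))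
    (PB_ge (g + (\<Sum>q\<in>Q. Poly_Mapping.map ((*) (u q)) (\<Sum>l\<in>cl q. Poly_Mapping.single l 1)))
       (A + sum u Q))"
  using assms(1,3)
proof (induction Q)
  case empty
  then show ?case
    using assms(2) by simp
next
  case (insert q Q)
  have "cp_within P 0 (PB_ge (\<Sum>l\<in>cl q. Poly_Mapping.single l 1) 1)"
    using insert.prems[of q] by (intro cp_within_premise) (simp add: clause_pbc_def)
  then have "cp_within P (of_bool (u q \<noteq> 1))
      (PB_ge (Poly_Mapping.map ((*) (u q)) (\<Sum>l\<in>cl q. Poly_Mapping.single l 1)) (u q))"
    using cp_within_scale[of P 0 _ 1 "u q"] insert.prems[of q] by simp
  with insert have "cp_within P (Suc (n + (\<Sum>q\<in>Q. Suc (of_bool (u q \<noteq> 1))) + of_bool (u q \<noteq> 1)))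
      (PB_ge (g + (\<Sum>q\<in>Q. Poly_Mapping.map ((*) (u q)) (\<Sum>l\<in>cl q. Poly_Mapping.single l 1)) +
        Poly_Mapping.map ((*) (u q)) (\<Sum>l\<in>cl q. Poly_Mapping.single l 1)) (A + sum u Q + u q))"
    by (intro cp_within_add) auto
  then show ?case
    unfolding sum.insert[OF insert.hyps] by (simp only: ac_simps add_Suc add_Suc_right)
qed

text \<open>Axiom, multiplication and addition make at most three steps per literal; literal axioms
  have degree 0 and leave \<open>A\<close> alone.\<close>

lemma cp_within_add_literals:
  assumes "finite B" "cp_within P n (PB_ge g A)" "\<And>b. b \<in> B \<Longrightarrow> m b \<ge> 0"
  shows "cp_within P (n + 3 * card B) (PB_ge (g + (\<Sum>b\<in>B. Poly_Mapping.single b (m b))) A)"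
  using assms(1,3)
proof (induction B)
  case empty
  then show ?case
    using assms(2) by simp
next
  case (insert b B)
  let ?g = "g + (\<Sum>b\<in>B. Poly_Mapping.single b (m b))"
  have IH: "cp_within P (n + 3 * card B) (PB_ge ?g A)"
    using insert by simp
  show ?case
  proof (cases "m b = 0")
    \<comment> \<open>Multiplication needs a positive factor, so a literal with multiplier 0 is
      skipped.\<close>
    case True
    then show ?thesis
      using insert by (auto intro: cp_within_mono[OF IH])
  next
    case False
    have "Poly_Mapping.map ((*) (m b)) (Poly_Mapping.single b 1) = Poly_Mapping.single b (m b)"
      by (rule poly_mapping_eqI)
         (simp add: Poly_Mapping.map.rep_eq lookup_single when_def)
    with cp_within_scale[OF cp_within_literal, of "m b" P b] False insert.prems[of b]
    have lit: "cp_within P (1 + of_bool (m b \<noteq> 1)) (PB_ge (Poly_Mapping.single b (m b)) 0)"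
      by simp
    have "cp_within P (n + 3 * card (insert b B)) (PB_ge (?g + Poly_Mapping.single b (m b)) (A + 0))"
      by (rule cp_within_mono[OF cp_within_add[OF IH lit]]) (use insert.hyps in auto)
    then show ?thesis
      using insert.hyps by (simp add: ac_simps)
  qed
qed

section \<open>Usage of objective literals under arbitrary multipliers\<close>

text \<open>This is \<open>used_cost\<close> with the core weights replaced by multipliers
  \<open>u\<close>, as the second claim must deviate from the weights.\<close>

definition usage :: "('v core \<Rightarrow> int) \<Rightarrow> 'v core set \<Rightarrow> 'v literal \<Rightarrow> int" where
  "usage u \<C> l = (\<Sum>q\<in>\<C>. u q * of_bool (neg l \<in> snd (snd q)))"

lemma usage_fst: "finite \<C> \<Longrightarrow> usage fst \<C> l = used_cost \<C> l"
  unfolding usage_def used_cost_def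
  by (rule sum.mono_neutral_cong_right) (auto split: prod.splits)

lemma usage_mono: "(\<And>q. q \<in> \<C> \<Longrightarrow> u q \<le> u' q) \<Longrightarrow> usage u \<C> l \<le> usage u' \<C> l"
  unfolding usage_def by (intro sum_mono mult_right_mono) auto

lemma usage_fun_upd:
  assumes "finite \<C>" "q \<in> \<C>" "neg l \<in> snd (snd q)"
  shows "usage (u(q := a)) \<C> l = usage u \<C> l - u q + a"
proof -
  have "(\<Sum>q'\<in>\<C> - {q}. (u(q := a)) q' * of_bool (neg l \<in> snd (snd q'))) =
      (\<Sum>q'\<in>\<C> - {q}. u q' * of_bool (neg l \<in> snd (snd q')))"
    by (intro sum.cong) auto
  then show ?thesis
    using assms(3) by (simp only: usage_def sum.remove[OF assms(1,2)]) simp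
qed

lemma cores_clause_iff: "l \<in> cores_clause \<C> \<longleftrightarrow> (\<exists>q\<in>\<C>. neg l \<in> fst (snd q))"
  by (force simp: cores_clause_def)

lemma core_clause_iff: "l \<in> core_clause q \<longleftrightarrow> neg l \<in> fst (snd q) \<or> neg l \<in> snd (snd q)"
  by (auto simp: core_clause_def in_neg_image_iff split: prod.splits)

text \<open>All reasons lie in the same consistent \<alpha>, so opposite literals in the clause
  would give an opposite pair in \<alpha>.\<close>

lemma cores_clause_consistent:
  assumes "partial_assignment \<alpha>" "\<And>q. q \<in> \<C> \<Longrightarrow> weighted_local_core F Obj \<alpha> q"
    and "l \<in> cores_clause \<C>"
  shows "neg l \<in> \<alpha>" "neg l \<notin> cores_clause \<C>"
proof -
  have *: "neg l' \<in> \<alpha>" if "l' \<in> cores_clause \<C>" for l'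
    using that assms(2) unfolding cores_clause_iff
    by (fastforce simp: weighted_local_core_def split: prod.splits)
  then show "neg l \<in> \<alpha>" "neg l \<notin> cores_clause \<C>"
    using assms(1,3) unfolding partial_assignment_def by blast+
qed

section \<open>The linear combination before division\<close>

text \<open>\<open>B\<close> holds the objective literals to be repaired: all of them for the first
  claim, all but \<open>l\<close> for the second.\<close>

lemma cp_within_cores:
  fixes Obj :: "'v literal \<Rightarrow>\<^sub>0 int" and v :: int
  assumes "maxsat_instance F Obj" "partial_assignment \<alpha>" "finite \<C>"
    and cores: "\<And>q. q \<in> \<C> \<Longrightarrow> weighted_local_core F Obj \<alpha> q"
    and u: "\<And>q. q \<in> \<C> \<Longrightarrow> u q > 0" and "k > 0"
    and usage: "\<And>l. l \<in> Poly_Mapping.keys Obj \<Longrightarrow> usage u \<C> l \<le> k * Poly_Mapping.lookup Obj l"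
    and B: "B \<subseteq> Poly_Mapping.keys Obj" "cores_clause \<C> \<inter> (Poly_Mapping.keys Obj - B) = {}"
  defines "P \<equiv> insert (PB_le Obj (v - 1)) ((\<lambda>q. clause_pbc (core_clause q)) ` \<C>)"
  obtains h where
    "cp_within P (of_bool (k \<noteq> 1) + (\<Sum>q\<in>\<C>. Suc (of_bool (u q \<noteq> 1))) + 3 * card B)
       (PB_ge h (k * (1 - v) + sum u \<C>))"
    "\<And>l. l \<in> cores_clause \<C> \<Longrightarrow> Poly_Mapping.lookup h l > 0"
    "\<And>l. l \<notin> cores_clause \<C> \<Longrightarrow> l \<notin> Poly_Mapping.keys Obj - B \<Longrightarrow> Poly_Mapping.lookup h l = 0"
    "\<And>l. l \<in> Poly_Mapping.keys Obj - B \<Longrightarrow>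
       Poly_Mapping.lookup h l = usage u \<C> l - k * Poly_Mapping.lookup Obj l"
proof -
  let ?c = "Poly_Mapping.lookup Obj"
  let ?T = "cores_clause \<C>"
  \<comment> \<open>The full cost is added for literals of the derived clause: a core may have \<open>R \<inter> K \<noteq> {}\<close>,
    and adding just the residual could cancel such a literal.\<close>
  define m where "m b = k * ?c b - (if b \<in> ?T then 0 else usage u \<C> b)" for b
  define g where "g = Poly_Mapping.map ((*) k) (- Obj) +
    (\<Sum>q\<in>\<C>. Poly_Mapping.map ((*) (u q)) (\<Sum>l\<in>core_clause q. Poly_Mapping.single l 1))"
  define h where "h = g + (\<Sum>b\<in>B. Poly_Mapping.single b (m b))"
  have "finite B"
    by (rule finite_subset[OF B(1) finite_keys])
  have m: "m b \<ge> 0" if "b \<in> B" for b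
    using assms(1) that B(1) usage[of b] \<open>k > 0\<close>
    by (fastforce simp: m_def maxsat_instance_def intro: less_imp_le)
  have "cp_within P 0 (PB_ge (- Obj) (1 - v))"
    by (rule cp_within_premise) (simp add: P_def PB_le_def)
  from cp_within_scale[OF this \<open>k > 0\<close>]
  have "cp_within P (of_bool (k \<noteq> 1)) (PB_ge (Poly_Mapping.map ((*) k) (- Obj)) (k * (1 - v)))"
    by simp
  then have "cp_within P (of_bool (k \<noteq> 1) + (\<Sum>q\<in>\<C>. Suc (of_bool (u q \<noteq> 1))))
       (PB_ge g (k * (1 - v) + sum u \<C>))"
    unfolding g_def by (intro cp_within_add_clauses) (auto simp: P_def assms)
  from cp_within_add_literals[OF \<open>finite B\<close> this m]
  have within: "cp_within P (of_bool (k \<noteq> 1) + (\<Sum>q\<in>\<C>. Suc (of_bool (u q \<noteq> 1))) + 3 * card B)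
       (PB_ge h (k * (1 - v) + sum u \<C>))"
    unfolding h_def .
  define s where "s l = (\<Sum>q\<in>\<C>. u q * of_bool (l \<in> core_clause q))" for l
  have "Poly_Mapping.lookup g l = s l - k * ?c l" for l
  proof -
    have "Poly_Mapping.lookup (Poly_Mapping.map ((*) (u q)) (\<Sum>l\<in>core_clause q. Poly_Mapping.single l 1)) l
      = u q * of_bool (l \<in> core_clause q)" if "q \<in> \<C>" for q
      using finite_core_clause[OF assms(2) cores[OF that]]
      by (simp add: Poly_Mapping.map.rep_eq lookup_sum lookup_single when_def)
    then have "Poly_Mapping.lookup (\<Sum>q\<in>\<C>. Poly_Mapping.map ((*) (u q))
        (\<Sum>l\<in>core_clause q. Poly_Mapping.single l 1)) l = s l"
      unfolding s_def lookup_sum by (intro sum.cong) auto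
    then show ?thesis
      by (simp add: g_def lookup_add Poly_Mapping.map.rep_eq when_def)
  qed
  then have h: "Poly_Mapping.lookup h l = s l - k * ?c l + (if l \<in> B then m l else 0)" for l
    using \<open>finite B\<close> by (simp add: h_def lookup_add lookup_sum lookup_single when_def)
  \<comment> \<open>Outside the derived clause a literal enters core clauses only through the sets
    \<open>K\<close>.\<close>
  have s_usage: "s l = usage u \<C> l" if "l \<notin> ?T" for l
    using that unfolding s_def usage_def by (intro sum.cong) (auto simp: cores_clause_iff core_clause_iff)
  have usage_0: "usage u \<C> l = 0" if "l \<notin> Poly_Mapping.keys Obj" for l
    unfolding usage_def
  proof (intro sum.neutral ballI)
    fix q assume "q \<in> \<C>"
    then show "u q * of_bool (neg l \<in> snd (snd q)) = 0"
      using cores[of q] that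
      by (auto simp: weighted_local_core_def split: prod.splits)
  qed
  have s_pos: "s l > 0" if "l \<in> ?T" for l
  proof -
    from that obtain q where "q \<in> \<C>" "l \<in> core_clause q"
      by (auto simp: cores_clause_iff core_clause_iff)
    then show ?thesis
      unfolding s_def using u by (intro sum_pos2[OF assms(3), of q]) (auto intro: less_imp_le)
  qed
  show ?thesis
  proof (rule that[OF within])
    fix l assume l: "l \<in> ?T"
    \<comment> \<open>Inside \<open>B\<close> the full cost is added back; outside \<open>B\<close>
      the literal is not objective and nothing was subtracted. Either way \<open>s l\<close>
      remains.\<close>
    then have "l \<in> B \<or> ?c l = 0"
      using B(2) by (auto simp: in_keys_iff)
    then show "Poly_Mapping.lookup h l > 0"
      using s_pos[OF l] l B(1) by (auto simp: h m_def)
  next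
    fix l assume "l \<notin> ?T" "l \<notin> Poly_Mapping.keys Obj - B"
    then show "Poly_Mapping.lookup h l = 0"
      using usage_0[of l] B(1) by (cases "l \<in> B") (auto simp: h m_def s_usage in_keys_iff)
  next
    fix l assume "l \<in> Poly_Mapping.keys Obj - B"
    then show "Poly_Mapping.lookup h l = usage u \<C> l - k * ?c l"
      using B(2) s_usage[of l] by (auto simp: h)
  qed
qed

text \<open>Serves every choice of multipliers in the second claim. Assumption \<open>n\<close>
  allots two steps per core, including the scaling of the objective bound; |O| - 1 repairs and one
  division then give the constant 3 * (-1) + 1 = -2. Assumption \<open>A\<close> concerns the degree
  after rewriting at \<open>l\<close>.\<close>

lemma cp_within_cores_literal:
  fixes Obj :: "'v literal \<Rightarrow>\<^sub>0 int" and v :: int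
  assumes "maxsat_instance F Obj" "partial_assignment \<alpha>" "finite \<C>"
    and cores: "\<And>q. q \<in> \<C> \<Longrightarrow> weighted_local_core F Obj \<alpha> q"
    and "\<And>q. q \<in> \<C> \<Longrightarrow> u q > 0" and "k > 0"
    and "\<And>l. l \<in> Poly_Mapping.keys Obj \<Longrightarrow> usage u \<C> l \<le> k * Poly_Mapping.lookup Obj l"
    and l: "l \<in> Poly_Mapping.keys Obj" "unassigned \<alpha> l"
    and d: "usage u \<C> l < k * Poly_Mapping.lookup Obj l"
    and A: "k * (1 - v) + sum u \<C> + (k * Poly_Mapping.lookup Obj l - usage u \<C> l) \<ge> 1"
    and n: "of_bool (k \<noteq> 1) + (\<Sum>q\<in>\<C>. Suc (of_bool (u q \<noteq> 1))) \<le> 2 * card \<C>"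
  defines "P \<equiv> insert (PB_le Obj (v - 1)) ((\<lambda>q. clause_pbc (core_clause q)) ` \<C>)"
  shows "\<exists>D. cp_derivation P D (clause_pbc (insert (neg l) (cores_clause \<C>))) \<and>
    int (length D) \<le> 3 * int (card (Poly_Mapping.keys Obj)) + 2 * int (card \<C>) - 2"
proof -
  let ?T = "cores_clause \<C>" and ?X = "Poly_Mapping.keys Obj"
  let ?d = "k * Poly_Mapping.lookup Obj l - usage u \<C> l"
  have "neg l' \<in> \<alpha>" if "l' \<in> ?T" for l'
    using cores_clause_consistent(1)[OF assms(2) cores] that by blast
  then have T: "l \<notin> ?T" "neg l \<notin> ?T"
    using l(2) unfolding unassigned_def by force+
  obtain h where h:
    "cp_within P (of_bool (k \<noteq> 1) + (\<Sum>q\<in>\<C>. Suc (of_bool (u q \<noteq> 1))) + 3 * card (?X - {l}))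
       (PB_ge h (k * (1 - v) + sum u \<C>))"
    "\<And>l'. l' \<in> ?T \<Longrightarrow> Poly_Mapping.lookup h l' > 0"
    "\<And>l'. l' \<notin> ?T \<Longrightarrow> l' \<notin> ?X - (?X - {l}) \<Longrightarrow> Poly_Mapping.lookup h l' = 0"
    "\<And>l'. l' \<in> ?X - (?X - {l}) \<Longrightarrow>
       Poly_Mapping.lookup h l' = usage u \<C> l' - k * Poly_Mapping.lookup Obj l'"
    using T(1) unfolding P_def
    by (rule_tac cp_within_cores[OF assms(1-7), of "?X - {l}" v]) auto
  \<comment> \<open>The coefficient of \<open>l\<close> is \<open>- ?d\<close>, so adding the pair
    cancels it, gives \<open>neg l\<close> the coefficient \<open>?d\<close> and raises the degree
    by \<open>?d\<close>.\<close>
  let ?h = "h + (Poly_Mapping.single l ?d + Poly_Mapping.single (neg l) ?d)"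
  have lookup: "Poly_Mapping.lookup ?h l' =
      Poly_Mapping.lookup h l' + (if l' = l \<or> l' = neg l then ?d else 0)" for l'
    by (auto simp: lookup_add lookup_single when_def)
  \<comment> \<open>Should \<open>neg l\<close> be objective as well, it belongs to the repaired
    literals and still has coefficient 0.\<close>
  have hl: "Poly_Mapping.lookup h l = - ?d" "Poly_Mapping.lookup h (neg l) = 0"
    using h(3)[of "neg l"] h(4)[of l] T l by auto
  have "cp_within P (Suc (of_bool (k \<noteq> 1) + (\<Sum>q\<in>\<C>. Suc (of_bool (u q \<noteq> 1))) + 3 * card (?X - {l})))
     (clause_pbc (insert (neg l) ?T))"
  proof (rule cp_within_clause[OF cp_within_equiv[OF h(1) pbc_equiv_add_literal_pair[of _ _ l ?d]] A])
    fix l' assume "l' \<in> insert (neg l) ?T"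
    then show "neg l' \<notin> insert (neg l) ?T" "Poly_Mapping.lookup ?h l' > 0"
      using cores_clause_consistent(2)[OF assms(2) cores, of \<C> l'] T d h(2)[of l'] hl
      unfolding lookup by auto
  next
    fix l' assume "l' \<notin> insert (neg l) ?T"
    then show "Poly_Mapping.lookup ?h l' = 0"
      using h(3)[of l'] hl unfolding lookup by auto
  qed
  then obtain D where D: "cp_derivation P D (clause_pbc (insert (neg l) ?T))"
    "length D \<le> Suc (of_bool (k \<noteq> 1) + (\<Sum>q\<in>\<C>. Suc (of_bool (u q \<noteq> 1))) + 3 * card (?X - {l}))"
    unfolding cp_within_def by blast
  \<comment> \<open>Keeps the natural-number subtraction in \<open>card ?X - 1\<close> from
    truncating.\<close>
  have "card ?X > 0"
    using l(1) by (auto simp: card_gt_0_iff)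
  then have "int (length D) \<le> 3 * int (card ?X) + 2 * int (card \<C>) - 2"
    using D(2) n l(1) by (simp add: card_Diff_singleton)
  with D(1) show ?thesis
    by blast
qed

section \<open>Choosing the multipliers for the two claims\<close>

theorem theorem1:
  fixes F :: "'v literal set set"
    and Obj :: "'v literal \<Rightarrow>\<^sub>0 int"
    and \<alpha> :: "'v literal set"
    and v :: int
    and \<C> :: "'v core set"
  assumes "maxsat_instance F Obj"
    and "partial_assignment \<alpha>"
    and "finite \<C>"
    and "\<And>q. q \<in> \<C> \<Longrightarrow> weighted_local_core F Obj \<alpha> q"
    and "compatible Obj \<C>"
  defines "P \<equiv> insert (PB_le Obj (v - 1)) ((\<lambda>q. clause_pbc (core_clause q)) ` \<C>)"
  shows "(cores_weight \<C> \<ge> v \<longrightarrow>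
            (\<exists>D. cp_derivation P D (clause_pbc (cores_clause \<C>)) \<and>
                 int (length D) \<le> 3 * int (card (Poly_Mapping.keys Obj)) + 2 * int (card \<C>) + 1)) \<and>
         (\<forall>l\<in>Poly_Mapping.keys Obj.
            unassigned \<alpha> l \<and> residual Obj l \<C> + cores_weight \<C> \<ge> v \<longrightarrow>
            (\<exists>D. cp_derivation P D (clause_pbc (insert (neg l) (cores_clause \<C>))) \<and>
                 int (length D) \<le> 3 * int (card (Poly_Mapping.keys Obj)) + 2 * int (card \<C>) - 2))"
proof (intro conjI impI ballI)
  let ?T = "cores_clause \<C>" and ?X = "Poly_Mapping.keys Obj" and ?c = "Poly_Mapping.lookup Obj"
  have w_pos: "fst q > 0" if "q \<in> \<C>" for q
    using assms(4)[OF that] by (auto simp: weighted_local_core_def)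
  have weight: "sum fst \<C> = cores_weight \<C>"
    by (simp add: cores_weight_def case_prod_beta)
  have usage: "usage fst \<C> l \<le> ?c l" if "l \<in> ?X" for l
    using assms(5) that by (simp add: usage_fst[OF assms(3)] compatible_def)
  have cost: "(\<Sum>q\<in>Q. Suc (of_bool (u q \<noteq> (1::int)))) \<le> 2 * card Q"
    for u and Q :: "'v core set"
  proof -
    have "(\<Sum>q\<in>Q. Suc (of_bool (u q \<noteq> 1))) \<le> (\<Sum>q\<in>Q. 2)"
      by (intro sum_mono) simp
    then show ?thesis
      by simp
  qed
  {
    assume "cores_weight \<C> \<ge> v"
    obtain h where h:
      "cp_within P (of_bool ((1::int) \<noteq> 1) + (\<Sum>q\<in>\<C>. Suc (of_bool (fst q \<noteq> 1))) + 3 * card ?X)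
         (PB_ge h (1 * (1 - v) + sum fst \<C>))"
      "\<And>l. l \<in> ?T \<Longrightarrow> Poly_Mapping.lookup h l > 0"
      "\<And>l. l \<notin> ?T \<Longrightarrow> l \<notin> ?X - ?X \<Longrightarrow> Poly_Mapping.lookup h l = 0"
      using w_pos usage unfolding P_def
      by (rule_tac cp_within_cores[OF assms(1-4), of fst 1 ?X v]) auto
    have "cp_within P (Suc (of_bool ((1::int) \<noteq> 1) + (\<Sum>q\<in>\<C>. Suc (of_bool (fst q \<noteq> 1))) + 3 * card ?X))
        (clause_pbc ?T)"
      using \<open>cores_weight \<C> \<ge> v\<close> weight h(2,3) cores_clause_consistent(2)[OF assms(2,4)]
      by (intro cp_within_clause[OF h(1)]) auto
    then show "\<exists>D. cp_derivation P D (clause_pbc ?T) \<and>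
        int (length D) \<le> 3 * int (card ?X) + 2 * int (card \<C>) + 1"
      unfolding cp_within_def using cost[of fst \<C>] by fastforce
  next
    fix l assume l: "l \<in> ?X" and "unassigned \<alpha> l \<and> residual Obj l \<C> + cores_weight \<C> \<ge> v"
    then have un: "unassigned \<alpha> l" and res: "?c l - usage fst \<C> l + sum fst \<C> \<ge> v"
      by (auto simp: weight residual_def usage_fst[OF assms(3)])
    note within = cp_within_cores_literal[where v = v, OF assms(1-4) _ _ _ l un, folded P_def]
    show "\<exists>D. cp_derivation P D (clause_pbc (insert (neg l) ?T)) \<and>
        int (length D) \<le> 3 * int (card ?X) + 2 * int (card \<C>) - 2"
    proof (cases "usage fst \<C> l < ?c l")
      case True
      show ?thesis
        by (rule within[of fst 1]) (use True res cost usage w_pos in auto)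
    next
      case False
      then have eq: "usage fst \<C> l = ?c l"
        using usage[OF l] by simp
      \<comment> \<open>A positive cost that is used up entirely must be charged to some core
        \<open>q\<close> with \<open>neg l\<close> in its \<open>K\<close>.\<close>
      moreover have "?c l > 0"
        using assms(1) l by (simp add: maxsat_instance_def)
      moreover have "usage fst \<C> l = 0" if "\<forall>q\<in>\<C>. neg l \<notin> snd (snd q)"
        unfolding usage_def by (intro sum.neutral) (use that in simp)
      ultimately obtain q where q: "q \<in> \<C>" "neg l \<in> snd (snd q)"
        by force
      show ?thesis
      proof (cases "fst q = 1")
        case False
        \<comment> \<open>Here the weight is at least 2, so the multiplier stays positive. The
          degree drops by 1, and rewriting at \<open>l\<close> with coefficient -1 restores
          it.\<close>
        let ?u = "fst(q := fst q - 1)"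
        have le: "usage ?u \<C> l' \<le> usage fst \<C> l'" for l'
          by (rule usage_mono) auto
        have "sum ?u \<C> = sum fst \<C> - 1"
          using q assms(3) by (simp add: sum.remove[of \<C> q])
        moreover have "usage ?u \<C> l = ?c l - 1"
          using usage_fun_upd[OF assms(3) q] eq by simp
        ultimately show ?thesis
          using res eq False w_pos w_pos[OF q(1)] cost[of ?u \<C>]
          by (intro within[of ?u 1]) (auto intro: order_trans[OF le] usage)
      next
        case True
        \<comment> \<open>After rewriting at \<open>l\<close> the degree is 2 * (1 -
          \<open>v\<close> + w(\<open>\<C>\<close>)), which is at least 2.\<close>
        let ?u = "(\<lambda>q. 2 * fst q)(q := 1)"
        have double: "usage (\<lambda>q. 2 * fst q) \<C> l' = 2 * usage fst \<C> l'" for l'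
          by (simp add: usage_def sum_distrib_left ac_simps)
        have le: "usage ?u \<C> l' \<le> 2 * usage fst \<C> l'" for l'
          unfolding double[symmetric] by (rule usage_mono) (use True in auto)
        have "sum ?u \<C> = 2 * sum fst \<C> - 1"
          using q assms(3) True by (simp add: sum.remove[of \<C> q] sum_distrib_left)
        moreover have "usage ?u \<C> l = 2 * ?c l - 1"
          using usage_fun_upd[OF assms(3) q] eq True by (simp add: double)
        \<comment> \<open>The core \<open>q\<close> takes a single addition and the others at most
          two steps each; with the doubling of the objective bound this is at most 2 *
          \<open>card \<C>\<close>.\<close>
        moreover have "(\<Sum>q\<in>\<C>. Suc (of_bool (?u q \<noteq> 1))) \<le> Suc (2 * card (\<C> - {q}))"
          using cost[of ?u "\<C> - {q}"] q assms(3) by (simp only: sum.remove[of \<C> q]) simp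
        moreover have "card \<C> > 0"
          using q assms(3) by (auto simp: card_gt_0_iff)
        ultimately show ?thesis
          using res eq w_pos q(1) usage
          by (intro within[of ?u 2]) (auto intro: order_trans[OF le] simp: card_Diff_singleton)
      qed
    qed
  }
qed

end
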